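(* Let $\varphi:\mathbb{R}\to\mathbb{R}$ be infinitely differentiable with $\varphi''>0$ everywhere, let $(\nu_n^{+})_{n\ge 0}$ and $(\nu_n^{-})_{n\geq 0}$ be sequences of real numbers with $\nu_0^->\nu_0^+$, and let $c=\dfrac{\varphi(\nu_0^+)-\varphi(\nu_0^-)}{\nu_0^+-\nu_0^-}$. For each choice of sign, let $u^{\pm}_{m,n}$ ($m\geq 1$, $0\le n\le m-1$) be the functions defined recursively in the context, on the domain $\{(x,t): t\ge 0,\ x>ct\}$ for the sign $+$ and on $\{(x,t): t\ge 0,\ x<ct\}$ for the sign $-$. Then for each choice of sign, and for all integers $m\ge 1$ and $0\le n\le m-1$, there exist constants $\alpha^{\pm}_{m,n,s}$ ($n\le s\le m-1$), independent of $x$ and $t$, such that for all $(x,t)$ in the corresponding domain $$u^{\pm}_{m,n}(x,t)=\sum_{s=n}^{m-1}\frac{\alpha^{\pm}_{m,n,s}\,t^s}{[x-\varphi'(\nu_0^{\pm})t]^{m+s}}.$$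
   Context: The functions $u^{\pm}_{m,n}$ are the coefficients of the formal outer expansion $U^{\pm}=\nu_0^{\pm}+\sum_{m\ge1}\sum_{n=0}^{m-1}\rho^{m-n}\varepsilon^n u^{\pm}_{m,n}(x,t)$ of the solution of $u_t+\varphi(u)_x=\varepsilon u_{xx}$ with initial data $\nu(x/\rho)$, where $\nu(\sigma)$ has the asymptotic expansions $\sum_{n\ge0}\nu_n^{\pm}\sigma^{-n}$ as $\sigma\to\pm\infty$. They satisfy the recurrence system of initial value problems $$\frac{\partial u^{\pm}_{m,n}}{\partial t}+\varphi'(\nu_0^{\pm})\frac{\partial u^{\pm}_{m,n}}{\partial x}=F^{\pm}_{m,n},\qquad u^{\pm}_{m,n}(x,0)=\delta_{n,0}\,\nu_m^{\pm}x^{-m},$$ where $\delta_{0,0}=1$, $\delta_{n,0}=0$ for $n\ne0$, and $$F^{\pm}_{m,n}=\frac{\partial^2u^{\pm}_{m-1,n-1}}{\partial x^2}-\sum_{q=2}^{m-n}\frac{\varphi^{(q)}(\nu_0^{\pm})}{q!}\sum_{\substack{i_1+\dots+i_q=m\\ j_1+\dots+j_q=n}}\frac{\partial}{\partial x}\left(u^{\pm}_{i_1,j_1}\cdots u^{\pm}_{i_q,j_q}\right).$$ The inner sum runs over integer tuples with $i_k\ge1$ and $0\le j_k\le i_k-1$ for every $k$; the term $\partial_x^2u^{\pm}_{m-1,n-1}$ is taken to be $0$ when $n=0$; empty sums are $0$. Explicitly, the $u^{\pm}_{m,n}$ are given recursively (by the method of characteristics) by $$u^{\pm}_{m,n}(x,t)=\frac{\delta_{n,0}\,\nu_m^{\pm}}{[x-\varphi'(\nu_0^{\pm})t]^m}+\int_0^tF^{\pm}_{m,n}\bigl(x-\varphi'(\nu_0^{\pm})(t-t'),t'\bigr)\,dt'.$$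 The convention $t^0=1$ is used also at $t=0$. *)

theory Defs
  imports "HOL-Analysis.Analysis"
begin

definition index_tuples :: "nat \<Rightarrow> nat \<Rightarrow> nat \<Rightarrow> (nat \<times> nat) list set" where
  "index_tuples q m n = {p. length p = q
     \<and> sum_list (map fst p) = m \<and> sum_list (map snd p) = n
     \<and> (\<forall>(i, j) \<in> set p. 1 \<le> i \<and> j \<le> i - 1)}"

lemma index_tuples_less:
  assumes "p \<in> index_tuples q m n" "2 \<le> q" "(i, j) \<in> set p"
  shows "i < m" "j \<le> n"
proof -
  from assms(3) obtain as bs where p: "p = as @ (i, j) # bs"
    by (auto simp: in_set_conv_decomp)
  from assms(1) have len: "length p = q" and m: "sum_list (map fst p) = m"
    and n: "sum_list (map snd p) = n"
    and pos: "\<And>i j. (i, j) \<in> set p \<Longrightarrow> 1 \<le> i"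
    by (auto simp: index_tuples_def)
  have "as @ bs \<noteq> []"
    using p len assms(2) by auto
  then obtain i' j' where ij': "(i', j') \<in> set (as @ bs)"
    by (metis list.set_intros(1) neq_Nil_conv surj_pair)
  then have "1 \<le> i'"
    using pos p by auto
  moreover have "i' \<le> sum_list (map fst (as @ bs))"
    using ij' by (intro member_le_sum_list) force+
  ultimately show "i < m"
    using m p by auto
  show "j \<le> n"
    using n p by auto
qed

text \<open>
  Both functions are total in \<open>(x, t)\<close> and carry no information where
  \<open>x - \<phi>'(\<nu>\<^sub>0) t = 0\<close>.  On the half \<open>x > c t\<close> or \<open>x < c t\<close> of \<open>t \<ge> 0\<close>
  belonging to the given sign, the values depend only on values in the same
  half: its section at fixed \<open>t\<close> is open in \<open>x\<close>, so \<open>deriv\<close> is local to it, and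
  it contains the backward characteristics of its points.  The coefficients
  are meant for \<open>n < m\<close>; only such ones occur in the recursion for \<open>n < m\<close>.
\<close>

function outer_coeff :: "(real \<Rightarrow> real) \<Rightarrow> (nat \<Rightarrow> real) \<Rightarrow> nat \<Rightarrow> nat \<Rightarrow> real \<Rightarrow> real \<Rightarrow> real"
  and outer_rhs :: "(real \<Rightarrow> real) \<Rightarrow> (nat \<Rightarrow> real) \<Rightarrow> nat \<Rightarrow> nat \<Rightarrow> real \<Rightarrow> real \<Rightarrow> real"
where
  "outer_coeff \<phi> \<nu> m n = (\<lambda>x t.
     (if n = 0 then \<nu> m else 0) / (x - deriv \<phi> (\<nu> 0) * t) ^ m
     + integral {0..t} (\<lambda>t'. outer_rhs \<phi> \<nu> m n (x - deriv \<phi> (\<nu> 0) * (t - t')) t'))"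
| "outer_rhs \<phi> \<nu> m n = (\<lambda>x t.
     (if n = 0 then 0 else (deriv ^^ 2) (\<lambda>y. outer_coeff \<phi> \<nu> (m - 1) (n - 1) y t) x)
     - (\<Sum>q = 2..m - n. (deriv ^^ q) \<phi> (\<nu> 0) / fact q *
          (\<Sum>p\<in>index_tuples q m n.
             deriv (\<lambda>y. \<Prod>(i, j)\<leftarrow>p. outer_coeff \<phi> \<nu> i j y t) x)))"
  by pat_completeness auto
termination
proof (relation "Wellfounded.measure
    (case_sum (\<lambda>(\<phi>, \<nu>, m, n). 2 * (m + n) + 1) (\<lambda>(\<phi>, \<nu>, m, n). 2 * (m + n)))", goal_cases)
  case (4 \<phi> \<nu> m n x t q p y r i j)
  then have "(i, j) \<in> set p" "p \<in> index_tuples q m n" "2 \<le> q"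
    by auto
  then have "i < m" "j \<le> n"
    using index_tuples_less by blast+
  then show ?case
    by simp
qed auto

declare outer_coeff.simps [simp del] outer_rhs.simps [simp del]

end

theory Submission
  imports Defs
begin

text \<open>
  On the domain, every term \<open>t\<^sup>s / (x - a t)\<^bsup>d + s\<^esup>\<close> is homogeneous of degree \<open>-d\<close> in
  \<open>(x, t)\<close>.  Products add the degrees and the exponents \<open>s\<close>; \<open>\<partial>/\<partial>x\<close> raises \<open>d\<close> by one and
  keeps \<open>s\<close>; and, because \<open>x - a t\<close> is constant along characteristics, integrating along them
  lowers \<open>d\<close> by one and raises \<open>s\<close> by one.  Induction on \<open>m\<close> then reduces to counting exponents.
  That the denominators do not vanish is the strict convexity of \<open>\<phi>\<close>: by the mean value theorem
  \<open>c = \<phi>'(\<xi>)\<close> with \<open>\<xi>\<close> strictly between \<open>\<nu>\<^sub>0\<^sup>+\<close> and \<open>\<nu>\<^sub>0\<^sup>-\<close>.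
\<close>

lemma DERIV_const_divide_power:
  fixes k :: real
  assumes "x - b \<noteq> 0"
  shows "((\<lambda>y. k / (y - b) ^ n) has_real_derivative - real n * k / (x - b) ^ Suc n) (at x)"
proof -
  have "((\<lambda>z. k / z ^ n) has_real_derivative - real n * k / z ^ Suc n) (at z)" if "z \<noteq> 0" for z
  proof -
    have "((\<lambda>z. k / z ^ n) has_real_derivative
        (0 * z ^ n - k * (real n * z ^ (n - Suc 0))) / (z ^ n * z ^ n)) (at z)"
      using that by (intro DERIV_divide DERIV_const DERIV_pow) simp
    moreover have "(0 * z ^ n - k * (real n * z ^ (n - Suc 0))) / (z ^ n * z ^ n)
        = - real n * k / z ^ Suc n"
      \<comment> \<open>The case split resolves the truncated \<open>n - Suc 0\<close>; for
        \<open>n = 0\<close> both sides are zero.\<close>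
      using that by (cases n) (simp_all add: field_simps)
    ultimately show ?thesis
      by simp
  qed
  from this[OF assms] show ?thesis
    using DERIV_shift[of "\<lambda>z. k / z ^ n" _ x "- b"] by simp
qed

text \<open>One argument serves both signs: \<open>a\<close> stands for
  \<open>deriv \<phi> (\<nu> 0)\<close>, open sections make \<open>deriv\<close> in \<open>x\<close>
  local to \<open>D\<close>, and backward characteristics keep the integrals inside
  \<open>D\<close>.\<close>

locale characteristic_domain =
  fixes a :: real and D :: "(real \<times> real) set"
  assumes time_nonneg: "(x, t) \<in> D \<Longrightarrow> 0 \<le> t"
    and section_nhds: "(x, t) \<in> D \<Longrightarrow> \<forall>\<^sub>F y in nhds x. (y, t) \<in> D"
    and backward: "(x, t) \<in> D \<Longrightarrow> 0 \<le> r \<Longrightarrow> r \<le> t \<Longrightarrow> (x - a * (t - r), r) \<in> D"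
    and off_characteristic: "(x, t) \<in> D \<Longrightarrow> x - a * t \<noteq> 0"
begin

text \<open>The degree \<open>d\<close> and the exponent set \<open>S\<close> are separate
  parameters, since differentiation changes only \<open>d\<close> and passing to a common range
  changes only \<open>S\<close>.\<close>

definition outer_sum :: "nat \<Rightarrow> nat set \<Rightarrow> (real \<Rightarrow> real \<Rightarrow> real) \<Rightarrow> bool" where
  "outer_sum d S f \<longleftrightarrow> (\<exists>\<alpha>. \<forall>(x, t) \<in> D. f x t = (\<Sum>s\<in>S. \<alpha> s * t ^ s / (x - a * t) ^ (d + s)))"

lemma outer_sumI:
  assumes "\<And>x t. (x, t) \<in> D \<Longrightarrow> f x t = (\<Sum>s\<in>S. \<alpha> s * t ^ s / (x - a * t) ^ (d + s))"
  shows "outer_sum d S f"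
  using assms unfolding outer_sum_def by blast

lemma outer_sumE:
  assumes "outer_sum d S f"
  obtains \<alpha> where "\<And>x t. (x, t) \<in> D \<Longrightarrow> f x t = (\<Sum>s\<in>S. \<alpha> s * t ^ s / (x - a * t) ^ (d + s))"
  using assms unfolding outer_sum_def by blast

lemma outer_sum_cong:
  assumes "outer_sum d S f" "\<And>x t. (x, t) \<in> D \<Longrightarrow> g x t = f x t"
  shows "outer_sum d S g"
  using assms unfolding outer_sum_def by (metis (no_types, lifting) case_prodI2 case_prodD)

section \<open>Linear combinations and products of expansions\<close>

lemma outer_sum_monom:
  assumes "finite S" "s \<in> S"
  shows "outer_sum d S (\<lambda>x t. k * t ^ s / (x - a * t) ^ (d + s))"
proof (rule outer_sumI)
  fix x t
  have "(\<Sum>r\<in>S. (if r = s then k else 0) * t ^ r / (x - a * t) ^ (d + r))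
      = (\<Sum>r\<in>S. if r = s then k * t ^ s / (x - a * t) ^ (d + s) else 0)"
    by (intro sum.cong) auto
  then show "k * t ^ s / (x - a * t) ^ (d + s)
      = (\<Sum>r\<in>S. (if r = s then k else 0) * t ^ r / (x - a * t) ^ (d + r))"
    using assms by simp
qed

lemma outer_sum_zero: "outer_sum d S (\<lambda>x t. 0)"
  by (rule outer_sumI[where \<alpha> = "\<lambda>_. 0"]) simp

lemma outer_sum_add:
  assumes "outer_sum d S f" "outer_sum d S g"
  shows "outer_sum d S (\<lambda>x t. f x t + g x t)"
proof -
  obtain \<alpha> \<beta>
    where "\<And>x t. (x, t) \<in> D \<Longrightarrow> f x t = (\<Sum>s\<in>S. \<alpha> s * t ^ s / (x - a * t) ^ (d + s))"
      and "\<And>x t. (x, t) \<in> D \<Longrightarrow> g x t = (\<Sum>s\<in>S. \<beta> s * t ^ s / (x - a * t) ^ (d + s))"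
    using assms by (elim outer_sumE) blast
  then show ?thesis
    by (intro outer_sumI[where \<alpha> = "\<lambda>s. \<alpha> s + \<beta> s"])
      (simp add: sum.distrib distrib_right add_divide_distrib)
qed

lemma outer_sum_scale:
  assumes "outer_sum d S f"
  shows "outer_sum d S (\<lambda>x t. k * f x t)"
proof -
  obtain \<alpha> where "\<And>x t. (x, t) \<in> D \<Longrightarrow> f x t = (\<Sum>s\<in>S. \<alpha> s * t ^ s / (x - a * t) ^ (d + s))"
    using assms by (elim outer_sumE) blast
  then show ?thesis
    by (intro outer_sumI[where \<alpha> = "\<lambda>s. k * \<alpha> s"]) (simp add: sum_distrib_left mult.assoc)
qed

lemma outer_sum_diff:
  assumes "outer_sum d S f" "outer_sum d S g"
  shows "outer_sum d S (\<lambda>x t. f x t - g x t)"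
  using outer_sum_add[OF assms(1) outer_sum_scale[OF assms(2), of "-1"]] by simp

lemma outer_sum_sum:
  assumes "\<And>i. i \<in> I \<Longrightarrow> outer_sum d S (f i)"
  shows "outer_sum d S (\<lambda>x t. \<Sum>i\<in>I. f i x t)"
  using assms
  by (induction I rule: infinite_finite_induct) (auto intro: outer_sum_zero outer_sum_add)

text \<open>The coefficients extend by zero; adding up the monomials again, now inside
  \<open>T\<close>, does this without naming the extension.\<close>

lemma outer_sum_mono:
  assumes "outer_sum d S f" "S \<subseteq> T" "finite T"
  shows "outer_sum d T f"
proof -
  obtain \<alpha> where \<alpha>: "\<And>x t. (x, t) \<in> D \<Longrightarrow> f x t = (\<Sum>s\<in>S. \<alpha> s * t ^ s / (x - a * t) ^ (d + s))"
    using assms by (elim outer_sumE) blast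
  have "outer_sum d T (\<lambda>x t. \<Sum>s\<in>S. \<alpha> s * t ^ s / (x - a * t) ^ (d + s))"
    using assms by (intro outer_sum_sum outer_sum_monom) auto
  then show ?thesis
    by (rule outer_sum_cong) (rule \<alpha>)
qed

lemma outer_sum_mult:
  assumes "outer_sum d {k..l} f" "outer_sum e {k'..l'} g"
  shows "outer_sum (d + e) {k + k'..l + l'} (\<lambda>x t. f x t * g x t)"
proof -
  obtain \<alpha> \<beta>
    where \<alpha>: "\<And>x t. (x, t) \<in> D \<Longrightarrow> f x t = (\<Sum>s=k..l. \<alpha> s * t ^ s / (x - a * t) ^ (d + s))"
      and \<beta>: "\<And>x t. (x, t) \<in> D \<Longrightarrow> g x t = (\<Sum>s=k'..l'. \<beta> s * t ^ s / (x - a * t) ^ (e + s))"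
    using assms by (elim outer_sumE) blast
  \<comment> \<open>Different pairs \<open>(s, r)\<close> can share an exponent
    \<open>s + r\<close>; adding the products as monomials collects them without a convolution
    formula.\<close>
  have "outer_sum (d + e) {k + k'..l + l'}
      (\<lambda>x t. \<Sum>s=k..l. \<Sum>r=k'..l'. \<alpha> s * \<beta> r * t ^ (s + r) / (x - a * t) ^ (d + e + (s + r)))"
    by (intro outer_sum_sum outer_sum_monom) auto
  then show ?thesis
    by (rule outer_sum_cong)
      (simp add: \<alpha> \<beta> sum_product power_add algebra_simps)
qed

text \<open>The top exponent of each factor is one below its degree, so the product loses one per
  factor. The length bound is proved alongside because the subtraction is truncated.\<close>

lemma outer_sum_prod_list:
  assumes "\<And>i j. (i, j) \<in> set p \<Longrightarrow> 1 \<le> i \<and> outer_sum i {j..i - 1} (f i j)"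
  shows "length p \<le> sum_list (map fst p) \<and>
    outer_sum (sum_list (map fst p)) {sum_list (map snd p)..sum_list (map fst p) - length p}
      (\<lambda>x t. \<Prod>(i, j)\<leftarrow>p. f i j x t)"
  using assms
proof (induction p)
  case Nil
  show ?case
    \<comment> \<open>The empty product is the monomial \<open>1\<close> of degree 0 and exponent
      0.\<close>
    using outer_sum_monom[of "{0}" 0 0 1] by simp
next
  case (Cons ij p)
  obtain i j where ij: "ij = (i, j)"
    by (cases ij)
  have le: "length p \<le> sum_list (map fst p)" and "1 \<le> i"
    using Cons ij by auto
  moreover have "outer_sum (i + sum_list (map fst p))
      {j + sum_list (map snd p)..(i - 1) + (sum_list (map fst p) - length p)}
      (\<lambda>x t. f i j x t * (\<Prod>(i, j)\<leftarrow>p. f i j x t))"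
    using Cons ij by (intro outer_sum_mult) auto
  ultimately show ?case
    using ij by simp
qed

section \<open>Differentiation in space and integration along characteristics\<close>

lemma outer_sum_deriv:
  assumes "outer_sum d S f"
  shows "outer_sum (Suc d) S (\<lambda>x t. deriv (\<lambda>y. f y t) x)"
proof -
  obtain \<alpha> where \<alpha>: "\<And>x t. (x, t) \<in> D \<Longrightarrow> f x t = (\<Sum>s\<in>S. \<alpha> s * t ^ s / (x - a * t) ^ (d + s))"
    using assms by (elim outer_sumE) blast
  show ?thesis
  proof (rule outer_sumI)
    fix x t
    assume xt: "(x, t) \<in> D"
    then have nz: "x - a * t \<noteq> 0"
      by (rule off_characteristic)
    \<comment> \<open>The formula is known only on \<open>D\<close>, so the derivative is
      transferred through a neighbourhood of \<open>x\<close> at fixed \<open>t\<close>.\<close>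
    have "\<forall>\<^sub>F y in nhds x. f y t = (\<Sum>s\<in>S. \<alpha> s * t ^ s / (y - a * t) ^ (d + s))"
      using section_nhds[OF xt] by eventually_elim (rule \<alpha>)
    then have "deriv (\<lambda>y. f y t) x = deriv (\<lambda>y. \<Sum>s\<in>S. \<alpha> s * t ^ s / (y - a * t) ^ (d + s)) x"
      by (rule deriv_cong_ev) simp
    also have "\<dots> = (\<Sum>s\<in>S. - real (d + s) * \<alpha> s * t ^ s / (x - a * t) ^ (Suc d + s))"
    proof (intro DERIV_imp_deriv DERIV_sum)
      fix s
      show "((\<lambda>y. \<alpha> s * t ^ s / (y - a * t) ^ (d + s)) has_real_derivative
          - real (d + s) * \<alpha> s * t ^ s / (x - a * t) ^ (Suc d + s)) (at x)"
        using DERIV_const_divide_power[OF nz, of "\<alpha> s * t ^ s" "d + s"] by (simp add: mult.assoc)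
    qed
    finally show "deriv (\<lambda>y. f y t) x
        = (\<Sum>s\<in>S. - real (d + s) * \<alpha> s * t ^ s / (x - a * t) ^ (Suc d + s))" .
  qed
qed

text \<open>The denominator is constant on the characteristic, so only the power of time is
  integrated. The power \<open>Suc d + s\<close> of the denominator stays and is read as
  \<open>d + Suc s\<close>.\<close>

lemma outer_sum_integral:
  assumes "outer_sum (Suc d) S f" "finite S"
  shows "outer_sum d (Suc ` S) (\<lambda>x t. integral {0..t} (\<lambda>r. f (x - a * (t - r)) r))"
proof -
  obtain \<alpha> where \<alpha>: "\<And>x t. (x, t) \<in> D \<Longrightarrow>
      f x t = (\<Sum>s\<in>S. \<alpha> s * t ^ s / (x - a * t) ^ (Suc d + s))"
    using assms by (elim outer_sumE) blast
  have "outer_sum d (Suc ` S)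
      (\<lambda>x t. \<Sum>s\<in>S. \<alpha> s / Suc s * t ^ Suc s / (x - a * t) ^ (d + Suc s))"
    using assms by (intro outer_sum_sum outer_sum_monom) auto
  then show ?thesis
  proof (rule outer_sum_cong)
    fix x t
    assume xt: "(x, t) \<in> D"
    \<comment> \<open>The boundary term at 0 is written out to fit the fundamental theorem; it
      vanishes because \<open>Suc s\<close> is positive.\<close>
    have "((\<lambda>r. \<Sum>s\<in>S. \<alpha> s * r ^ s / (x - a * t) ^ (Suc d + s)) has_integral
        (\<Sum>s\<in>S. \<alpha> s / Suc s * t ^ Suc s / (x - a * t) ^ (d + Suc s)
          - \<alpha> s / Suc s * 0 ^ Suc s / (x - a * t) ^ (d + Suc s))) {0..t}"
    proof (intro has_integral_sum fundamental_theorem_of_calculus)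
      fix s r
      have "((\<lambda>r. \<alpha> s / Suc s * r ^ Suc s / (x - a * t) ^ (d + Suc s)) has_real_derivative
          \<alpha> s / Suc s * (real (Suc s) * r ^ s) / (x - a * t) ^ (d + Suc s)) (at r within {0..t})"
        using DERIV_cmult[OF DERIV_pow[of "Suc s" r "{0..t}"],
            of "\<alpha> s / Suc s / (x - a * t) ^ (d + Suc s)"]
        by (simp del: of_nat_Suc power_Suc)
      then show "((\<lambda>r. \<alpha> s / Suc s * r ^ Suc s / (x - a * t) ^ (d + Suc s)) has_vector_derivative
          \<alpha> s * r ^ s / (x - a * t) ^ (Suc d + s)) (at r within {0..t})"
        by (simp add: has_real_derivative_iff_has_vector_derivative del: of_nat_Suc)
    qed (use assms time_nonneg[OF xt] in auto)
    then have "integral {0..t} (\<lambda>r. \<Sum>s\<in>S. \<alpha> s * r ^ s / (x - a * t) ^ (Suc d + s))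
        = (\<Sum>s\<in>S. \<alpha> s / Suc s * t ^ Suc s / (x - a * t) ^ (d + Suc s))"
      by (intro integral_unique) simp
    moreover have "integral {0..t} (\<lambda>r. f (x - a * (t - r)) r)
        = integral {0..t} (\<lambda>r. \<Sum>s\<in>S. \<alpha> s * r ^ s / (x - a * t) ^ (Suc d + s))"
    proof (rule integral_cong)
      fix r
      assume "r \<in> {0..t}"
      then have "(x - a * (t - r), r) \<in> D"
        by (intro backward[OF xt]) auto
      moreover have "x - a * (t - r) - a * r = x - a * t"
        by (simp add: algebra_simps)
      ultimately show "f (x - a * (t - r)) r
          = (\<Sum>s\<in>S. \<alpha> s * r ^ s / (x - a * t) ^ (Suc d + s))"
        using \<alpha> by metis
    qed
    ultimately show "integral {0..t} (\<lambda>r. f (x - a * (t - r)) r)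
        = (\<Sum>s\<in>S. \<alpha> s / Suc s * t ^ Suc s / (x - a * t) ^ (d + Suc s))"
      by simp
  qed
qed

section \<open>The recursion for the coefficients\<close>

text \<open>Two derivatives of a term of degree \<open>m - 1\<close> and one derivative of a product
  of degree \<open>m\<close> both have degree \<open>Suc m\<close>. The half-open range is empty for
  \<open>m = 1\<close>, where a closed range ending at the truncated \<open>m - 2\<close> would
  still contain 0.\<close>

lemma outer_sum_rhs:
  assumes "1 \<le> m" "n \<le> m - 1"
    and IH: "\<And>i j. i < m \<Longrightarrow> 1 \<le> i \<Longrightarrow> j \<le> i - 1 \<Longrightarrow> outer_sum i {j..i - 1} (outer_coeff \<phi> \<nu> i j)"
  shows "outer_sum (Suc m) {n - 1..<m - 1} (outer_rhs \<phi> \<nu> m n)"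
  unfolding outer_rhs.simps
proof (intro outer_sum_diff outer_sum_sum outer_sum_scale)
  show "outer_sum (Suc m) {n - 1..<m - 1}
      (\<lambda>x t. if n = 0 then 0 else (deriv ^^ 2) (\<lambda>y. outer_coeff \<phi> \<nu> (m - 1) (n - 1) y t) x)"
  proof (cases "n = 0")
    case True
    then show ?thesis
      by (simp add: outer_sum_zero)
  next
    case False
    then have "outer_sum (m - 1) {n - 1..m - 1 - 1} (outer_coeff \<phi> \<nu> (m - 1) (n - 1))"
      using assms(1,2) by (intro IH) auto
    then have "outer_sum (Suc (Suc (m - 1))) {n - 1..m - 1 - 1}
        (\<lambda>x t. deriv (\<lambda>y. deriv (\<lambda>z. outer_coeff \<phi> \<nu> (m - 1) (n - 1) z t) y) x)"
      by (intro outer_sum_deriv)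
    then have "outer_sum (Suc (Suc (m - 1))) {n - 1..<m - 1}
        (\<lambda>x t. deriv (\<lambda>y. deriv (\<lambda>z. outer_coeff \<phi> \<nu> (m - 1) (n - 1) z t) y) x)"
      \<comment> \<open>Here \<open>0 < n \<le> m - 1\<close> forces \<open>m \<ge> 2\<close>, so
        \<open>m - 1 - 1\<close> lies strictly below \<open>m - 1\<close>.\<close>
      by (rule outer_sum_mono) (use False assms(1,2) in auto)
    then show ?thesis
      using False assms(1) by (simp add: numeral_2_eq_2)
  qed
next
  fix q p
  assume q: "q \<in> {2..m - n}" and p: "p \<in> index_tuples q m n"
  then have len: "length p = q" and m: "sum_list (map fst p) = m" and n: "sum_list (map snd p) = n"
    by (auto simp: index_tuples_def)
  have "1 \<le> i \<and> outer_sum i {j..i - 1} (outer_coeff \<phi> \<nu> i j)" if ij: "(i, j) \<in> set p" for i j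
  proof -
    have "1 \<le> i" "j \<le> i - 1"
      using p ij by (auto simp: index_tuples_def)
    moreover have "i < m"
      using index_tuples_less(1)[OF p _ ij] q by simp
    ultimately show ?thesis
      using IH by blast
  qed
  then have "outer_sum m {n..m - q} (\<lambda>x t. \<Prod>(i, j)\<leftarrow>p. outer_coeff \<phi> \<nu> i j x t)"
    using outer_sum_prod_list[of p "outer_coeff \<phi> \<nu>"] unfolding len m n by blast
  then have "outer_sum (Suc m) {n..m - q}
      (\<lambda>x t. deriv (\<lambda>y. \<Prod>(i, j)\<leftarrow>p. outer_coeff \<phi> \<nu> i j y t) x)"
    by (rule outer_sum_deriv)
  then show "outer_sum (Suc m) {n - 1..<m - 1}
      (\<lambda>x t. deriv (\<lambda>y. \<Prod>(i, j)\<leftarrow>p. outer_coeff \<phi> \<nu> i j y t) x)"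
    \<comment> \<open>At least two factors give \<open>m - q \<le> m - 2\<close>.\<close>
    by (rule outer_sum_mono) (use q in auto)
qed

text \<open>Strong induction on \<open>m\<close> alone suffices, with \<open>n\<close> arbitrary:
  the right-hand side involves only coefficients whose first index is smaller.\<close>

lemma outer_sum_coeff:
  assumes a: "deriv \<phi> (\<nu> 0) = a" and "1 \<le> m" "n \<le> m - 1"
  shows "outer_sum m {n..m - 1} (outer_coeff \<phi> \<nu> m n)"
  using assms(2,3)
proof (induction m arbitrary: n rule: less_induct)
  case (less m)
  have "outer_sum (Suc m) {n - 1..<m - 1} (outer_rhs \<phi> \<nu> m n)"
    using less by (intro outer_sum_rhs) auto
  then have "outer_sum m (Suc ` {n - 1..<m - 1})
      (\<lambda>x t. integral {0..t} (\<lambda>r. outer_rhs \<phi> \<nu> m n (x - a * (t - r)) r))"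
    by (rule outer_sum_integral) simp
  then have "outer_sum m {n..m - 1}
      (\<lambda>x t. integral {0..t} (\<lambda>r. outer_rhs \<phi> \<nu> m n (x - a * (t - r)) r))"
    \<comment> \<open>The shifted range is \<open>{n..m - 1}\<close> for \<open>n > 0\<close> and
      starts at 1 for \<open>n = 0\<close>.\<close>
    by (rule outer_sum_mono) auto
  \<comment> \<open>The initial datum is the monomial with \<open>s = 0\<close>, an exponent in the
    range exactly when \<open>n = 0\<close>, the only case in which the datum is present.\<close>
  moreover have "outer_sum m {n..m - 1} (\<lambda>x t. (if n = 0 then \<nu> m else 0) / (x - a * t) ^ m)"
    using outer_sum_monom[of "{n..m - 1}" 0 m "\<nu> m"] outer_sum_zero by (cases "n = 0") auto
  ultimately show ?case
    unfolding outer_coeff.simps a by (rule outer_sum_add[rotated])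
qed

lemma outer_coeff_expansion:
  assumes "deriv \<phi> (\<nu> 0) = a" "1 \<le> m" "n \<le> m - 1"
  shows "\<exists>\<alpha>. \<forall>x t. (x, t) \<in> D \<longrightarrow>
    outer_coeff \<phi> \<nu> m n x t = (\<Sum>s = n..m - 1. \<alpha> s * t ^ s / (x - a * t) ^ (m + s))"
  using outer_sum_coeff[of \<phi> \<nu> m n] assms unfolding outer_sum_def by fast

end

section \<open>The two domains and the characteristic speeds\<close>

text \<open>Going back from time \<open>t\<close> to \<open>r\<close> along a characteristic adds
  \<open>(c - a) * (t - r) \<ge> 0\<close> to \<open>x - c * t\<close>, so the path stays to the
  right of the line of speed \<open>c\<close>.\<close>

lemma characteristic_domain_right:
  assumes "a < c"
  shows "characteristic_domain a {(x, t). 0 \<le> t \<and> c * t < x}"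
proof
  have lt: "a * t \<le> c * t" if "0 \<le> t" for t
    using assms that by (intro mult_right_mono) auto
  fix x t r :: real
  assume xt: "(x, t) \<in> {(x, t). 0 \<le> t \<and> c * t < x}"
  then show "0 \<le> t" "x - a * t \<noteq> 0"
    using lt[of t] by auto
  show "\<forall>\<^sub>F y in nhds x. (y, t) \<in> {(x, t). 0 \<le> t \<and> c * t < x}"
    using xt eventually_nhds_in_open[of "{c * t<..}" x] by (auto elim: eventually_mono)
  assume "0 \<le> r" "r \<le> t"
  then show "(x - a * (t - r), r) \<in> {(x, t). 0 \<le> t \<and> c * t < x}"
    using xt lt[of "t - r"] by (auto simp: algebra_simps)
qed

lemma characteristic_domain_left:
  assumes "c < a"
  shows "characteristic_domain a {(x, t). 0 \<le> t \<and> x < c * t}"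
proof
  have lt: "c * t \<le> a * t" if "0 \<le> t" for t
    using assms that by (intro mult_right_mono) auto
  fix x t r :: real
  assume xt: "(x, t) \<in> {(x, t). 0 \<le> t \<and> x < c * t}"
  then show "0 \<le> t" "x - a * t \<noteq> 0"
    using lt[of t] by auto
  show "\<forall>\<^sub>F y in nhds x. (y, t) \<in> {(x, t). 0 \<le> t \<and> x < c * t}"
    using xt eventually_nhds_in_open[of "{..<c * t}" x] by (auto elim: eventually_mono)
  assume "0 \<le> r" "r \<le> t"
  then show "(x - a * (t - r), r) \<in> {(x, t). 0 \<le> t \<and> x < c * t}"
    using xt lt[of "t - r"] by (auto simp: algebra_simps)
qed

text \<open>The chord slope is \<open>deriv \<phi>\<close> at an intermediate point, and
  \<open>deriv \<phi>\<close> is strictly increasing. For the chord between the two limit states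
  this is the Lax entropy condition on the speed \<open>c\<close>.\<close>

lemma convex_chord_slope:
  fixes \<phi> :: "real \<Rightarrow> real"
  assumes \<phi>: "\<phi> differentiable_on UNIV" and \<phi>': "deriv \<phi> differentiable_on UNIV"
    and convex: "\<And>v. deriv (deriv \<phi>) v > 0" and "u < v"
  shows "deriv \<phi> u < (\<phi> v - \<phi> u) / (v - u)" "(\<phi> v - \<phi> u) / (v - u) < deriv \<phi> v"
proof -
  have deriv: "(f has_real_derivative deriv f y) (at y)"
    if "f differentiable_on UNIV" for f :: "real \<Rightarrow> real" and y
    using that by (simp add: differentiable_on_def DERIV_deriv_iff_real_differentiable)
  obtain z where z: "u < z" "z < v" "\<phi> v - \<phi> u = (v - u) * deriv \<phi> z"
    using MVT2[OF \<open>u < v\<close>, of \<phi> "deriv \<phi>"] deriv[OF \<phi>] by blast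
  have "deriv \<phi> y < deriv \<phi> w" if "y < w" for y w
    using DERIV_pos_imp_increasing[OF that] deriv[OF \<phi>'] convex by blast
  then show "deriv \<phi> u < (\<phi> v - \<phi> u) / (v - u)" "(\<phi> v - \<phi> u) / (v - u) < deriv \<phi> v"
    using z \<open>u < v\<close> by auto
qed

theorem theorem1:
  fixes \<phi> :: "real \<Rightarrow> real" and \<nu>_plus \<nu>_minus :: "nat \<Rightarrow> real" and c :: real
  assumes smooth: "\<And>k. (deriv ^^ k) \<phi> differentiable_on UNIV"
    and convex: "\<And>v. (deriv ^^ 2) \<phi> v > 0"
    and jump: "\<nu>_minus 0 > \<nu>_plus 0"
    and speed: "c = (\<phi> (\<nu>_plus 0) - \<phi> (\<nu>_minus 0)) / (\<nu>_plus 0 - \<nu>_minus 0)"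
  shows "(\<forall>m\<ge>1. \<forall>n\<le>m - 1. \<exists>\<alpha> :: nat \<Rightarrow> real. \<forall>x t. t \<ge> 0 \<longrightarrow> x > c * t \<longrightarrow>
            outer_coeff \<phi> \<nu>_plus m n x t
              = (\<Sum>s = n..m - 1. \<alpha> s * t ^ s / (x - deriv \<phi> (\<nu>_plus 0) * t) ^ (m + s)))
       \<and> (\<forall>m\<ge>1. \<forall>n\<le>m - 1. \<exists>\<alpha> :: nat \<Rightarrow> real. \<forall>x t. t \<ge> 0 \<longrightarrow> x < c * t \<longrightarrow>
            outer_coeff \<phi> \<nu>_minus m n x t
              = (\<Sum>s = n..m - 1. \<alpha> s * t ^ s / (x - deriv \<phi> (\<nu>_minus 0) * t) ^ (m + s)))"
proof -
  have slope: "deriv \<phi> (\<nu>_plus 0) < (\<phi> (\<nu>_minus 0) - \<phi> (\<nu>_plus 0)) / (\<nu>_minus 0 - \<nu>_plus 0)"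
    "(\<phi> (\<nu>_minus 0) - \<phi> (\<nu>_plus 0)) / (\<nu>_minus 0 - \<nu>_plus 0) < deriv \<phi> (\<nu>_minus 0)"
    \<comment> \<open>Orders 0 and 1 of \<open>smooth\<close> give the differentiability of
      \<open>\<phi>\<close> and of \<open>deriv \<phi>\<close>.\<close>
    using smooth[of 0] smooth[of 1] convex jump
    by (auto intro!: convex_chord_slope simp: numeral_2_eq_2)
  have "c = (\<phi> (\<nu>_minus 0) - \<phi> (\<nu>_plus 0)) / (\<nu>_minus 0 - \<nu>_plus 0)"
    unfolding speed by (metis minus_diff_eq minus_divide_divide)
  with slope
  have "characteristic_domain (deriv \<phi> (\<nu>_plus 0)) {(x, t). 0 \<le> t \<and> c * t < x}"
    and "characteristic_domain (deriv \<phi> (\<nu>_minus 0)) {(x, t). 0 \<le> t \<and> x < c * t}"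
    by (simp_all only: characteristic_domain_right characteristic_domain_left)
  from this(1)[THEN characteristic_domain.outer_coeff_expansion, of \<phi> \<nu>_plus]
    this(2)[THEN characteristic_domain.outer_coeff_expansion, of \<phi> \<nu>_minus]
  show ?thesis
    by (simp add: imp_conjL)
qed

end
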